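(* Let $m\ge 1$ and let $h:[0,\infty)\to[0,\infty)$ be such that $y\mapsto h(y^ty)$ is a probability density on $\mathbb{R}^{m^2}$ and the function $x\mapsto x^{m^2/2}h(x)$ attains a finite positive maximum, at a point $x_h>0$. Let $Y\sim E_{m\times m}(0,\Sigma_{\mathrm r},\Sigma_{\mathrm c},h)$ for some $\Sigma_{\mathrm r},\Sigma_{\mathrm c}\in\mathcal{S}_+^m$. Let $\Omega=\{\Sigma_2\otimes\Sigma_1:\Sigma_1,\Sigma_2\in\mathcal{S}_+^m\}$ and $\omega=\{D_2\otimes D_1:D_1,D_2\in\mathcal{D}_+^m\}$, and for $V\in\Omega$ let $L_h(V)=|V|^{-1/2}h\left(\mathrm{vec}(Y)^tV^{-1}\mathrm{vec}(Y)\right)$. Then, with probability one: (1) $L_h$ is bounded on $\Omega$. For each $W\in\{\Omega,\omega\}$, a maximizer over $W$ of the normal likelihood $V\mapsto(2\pi)^{-m^2/2}|V|^{-1/2}\exp\left(-\tfrac12\mathrm{vec}(Y)^tV^{-1}\mathrm{vec}(Y)\right)$ exists, and for any such maximizer $\tilde V_W$ the matrix $\hat V_W=(m^2/x_h)\tilde V_W$ maximizes $L_h$ over $W$. (2) The likelihood ratio statistic is the same as in the normal case: $$2\log\left(\sup_{V\in\Omega}L_h(V)\right)-2\log\left(\sup_{V\in\omega}L_h(V)\right)=\log|\tilde V_\omega|-\log|\tilde V_\Omega|.$$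
   Context: $\mathcal{S}_+^m$ is the set of $m\times m$ real symmetric positive definite matrices and $\mathcal{D}_+^m$ the set of $m\times m$ diagonal matrices with positive diagonal entries. $|\cdot|$ is the determinant, $\otimes$ the Kronecker product, $\mathrm{vec}$ the column-stacking vectorization. A random $m\times m$ matrix $Y$ has the mean-zero square matrix variate elliptically contoured distribution $E_{m\times m}(0,\Sigma_{\mathrm r},\Sigma_{\mathrm c},h)$ if it has density $$f_Y(Y)=\frac{1}{|\Sigma_{\mathrm r}|^{m/2}|\Sigma_{\mathrm c}|^{m/2}}\,h\left(\mathrm{vec}(Y)^t(\Sigma_{\mathrm c}^{-1}\otimes\Sigma_{\mathrm r}^{-1})\mathrm{vec}(Y)\right)$$ with respect to Lebesgue measure on $\mathbb{R}^{m\times m}$. *)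

theory Defs
  imports "HOL-Probability.Probability"
begin

text \<open>
  An \<open>m \<times> m\<close> matrix is an element of \<open>real^'m^'m\<close>, with \<open>m = CARD('m)\<close>.  The coordinates of
  \<open>\<real>\<^sup>k\<close> for \<open>k = m\<^sup>2\<close> are indexed by pairs (column, row) rather than by single numbers; under the
  lexicographic order on pairs, \<open>vec_of\<close> stacks columns and \<open>kron A B\<close> is the block matrix with
  blocks \<open>A\<^sub>j\<^sub>l B\<close>.
\<close>

definition vec_of :: "real^'n^'m \<Rightarrow> real^('n \<times> 'm)" where
  "vec_of Y = (\<chi> p. Y $ snd p $ fst p)"

definition kron :: "real^'m^'m \<Rightarrow> real^'n^'n \<Rightarrow> real^('m \<times> 'n)^('m \<times> 'n)" where
  "kron A B = (\<chi> p q. A $ fst p $ fst q * B $ snd p $ snd q)"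

lemma vec_of_matrix_triple_product:
  fixes A :: "real^'m^'m" and B :: "real^'n^'n" and Y :: "real^'n^'m"
  shows "vec_of (A ** Y ** transpose B) = kron B A *v vec_of Y"
proof -
  have "(\<Sum>k\<in>UNIV. (\<Sum>l\<in>UNIV. A $ i $ l * Y $ l $ k) * B $ j $ k) =
        (\<Sum>q\<in>UNIV. B $ j $ fst q * A $ i $ snd q * Y $ snd q $ fst q)" for i j
    by (simp add: sum_distrib_right sum_distrib_left sum.cartesian_product case_prod_beta mult_ac
        flip: UNIV_Times_UNIV)
  then show ?thesis
    by (simp add: vec_of_def kron_def matrix_matrix_mult_def matrix_vector_mult_def
        transpose_def vec_eq_iff)
qed

definition posdef_matrices :: "(real^'n^'n) set" where
  "posdef_matrices = {A. transpose A = A \<and> (\<forall>x. x \<noteq> 0 \<longrightarrow> 0 < x \<bullet> (A *v x))}"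

definition posdiag_matrices :: "(real^'n^'n) set" where
  "posdiag_matrices = {A. (\<forall>i j. i \<noteq> j \<longrightarrow> A $ i $ j = 0) \<and> (\<forall>i. 0 < A $ i $ i)}"

definition Omega_full :: "(real^('m::finite \<times> 'm)^('m \<times> 'm)) set" where
  "Omega_full = {kron S2 S1 | S1 S2 :: real^'m^'m. S1 \<in> posdef_matrices \<and> S2 \<in> posdef_matrices}"

definition omega_diag :: "(real^('m::finite \<times> 'm)^('m \<times> 'm)) set" where
  "omega_diag = {kron D2 D1 | D1 D2 :: real^'m^'m. D1 \<in> posdiag_matrices \<and> D2 \<in> posdiag_matrices}"

definition elliptical_density ::
    "(real \<Rightarrow> real) \<Rightarrow> real^'m^'m \<Rightarrow> real^'m^'m \<Rightarrow> real^'m^'m \<Rightarrow> real" where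
  "elliptical_density h Sr Sc Y =
     1 / (det Sr powr (real CARD('m) / 2) * det Sc powr (real CARD('m) / 2)) *
     h (vec_of Y \<bullet> (kron (matrix_inv Sc) (matrix_inv Sr) *v vec_of Y))"

definition elliptical_lik ::
    "(real \<Rightarrow> real) \<Rightarrow> real^'m^'m \<Rightarrow> real^('m \<times> 'm)^('m \<times> 'm) \<Rightarrow> real" where
  "elliptical_lik h Y V = det V powr (- 1 / 2) * h (vec_of Y \<bullet> (matrix_inv V *v vec_of Y))"

definition normal_lik :: "real^'m^'m \<Rightarrow> real^('m \<times> 'm)^('m \<times> 'm) \<Rightarrow> real" where
  "normal_lik Y V = (2 * pi) powr (- (real CARD('m))\<^sup>2 / 2) * det V powr (- 1 / 2) *
     exp (- (1 / 2) * (vec_of Y \<bullet> (matrix_inv V *v vec_of Y)))"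

end

theory Submission
  imports Defs
begin

text \<open>
  Write \<open>q\<close> for the quadratic form of \<open>vec Y\<close> at \<open>V\<close> and \<open>n = m\<^sup>2\<close>.  Both \<open>\<Omega>\<close> and \<open>\<omega>\<close> are cones,
  and both likelihoods are the scale invariant function \<open>|V|\<^sup>-\<^sup>1\<^sup>/\<^sup>2 q\<^sup>-\<^sup>n\<^sup>/\<^sup>2\<close> of \<open>V\<close> times a function
  of \<open>q\<close> alone, the latter being maximal at \<open>q = n\<close> in the normal case and at \<open>q = x_h\<close> in the
  elliptical case.  So the maximizers differ by a factor \<open>n / x_h\<close>, and only the existence of the
  normal maximizers depends on \<open>Y\<close>.

  Over \<open>\<Omega>\<close> and for invertible \<open>Y\<close> the maximizer is explicit, \<open>V = I \<otimes> Y Y\<^sup>t / m\<close>: with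
  \<open>C = Y\<^sup>t \<Sigma>\<^sub>1\<^sup>-\<^sup>1 Y\<close>, diagonalizing \<open>C\<close> and \<open>\<Sigma>\<^sub>2\<close> simultaneously reduces its optimality to
  \<open>ln x \<le> x - 1\<close>.  Over \<open>\<omega>\<close> and for \<open>Y\<close> without zero entries, the negative log-likelihood is a sum
  of terms \<open>ln v + y\<^sup>2 / v\<close>, which is coercive on the closed set of positive tables of rank one.
\<close>

section \<open>Simultaneous diagonalization\<close>

lemma symmetric_inner_mult:
  fixes A :: "real^'n^'n"
  assumes "transpose A = A"
  shows "x \<bullet> (A *v y) = y \<bullet> (A *v x)"
  by (metis assms dot_lmul_matrix inner_commute transpose_matrix_vector)

text \<open>A maximizer \<open>w\<close> of the Rayleigh quotient (x . B x) / (x . A x) over the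
  \<open>A\<close>-orthogonal complement of the vectors found so far is the next eigenvector. The
  complement is nonzero because \<open>k < CARD('n)\<close>. The first variation gives the
  eigenvector equation tested against the complement, and the equations for the earlier
  \<open>f i\<close> give it on their span.\<close>

lemma generalized_eigenvector_step:
  fixes A B :: "real^'n^'n" and f :: "nat \<Rightarrow> real^'n"
  assumes A: "A \<in> posdef_matrices" and B: "transpose B = B" and k: "k < CARD('n)"
    and orth: "\<And>i j. i < k \<Longrightarrow> j < k \<Longrightarrow> f i \<bullet> (A *v f j) = (if i = j then 1 else 0)"
    and eig: "\<And>i. i < k \<Longrightarrow> B *v f i = l i *\<^sub>R (A *v f i)"
  obtains w c where "w \<bullet> (A *v w) = 1" "\<And>i. i < k \<Longrightarrow> f i \<bullet> (A *v w) = 0"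
    "B *v w = c *\<^sub>R (A *v w)"
proof -
  have At: "transpose A = A" and Apos: "\<And>x. x \<noteq> 0 \<Longrightarrow> 0 < x \<bullet> (A *v x)"
    using A by (auto simp: posdef_matrices_def)
  define U where "U = {x. \<forall>i<k. x \<bullet> (A *v f i) = 0}"
  have U_comb: "x + t *\<^sub>R y \<in> U" if "x \<in> U" "y \<in> U" for x y t
    using that by (simp add: U_def inner_add_left)
  have "dim ((\<lambda>i. A *v f i) ` {..<k}) \<le> card ((\<lambda>i. A *v f i) ` {..<k})"
    by (rule dim_le_card') simp
  also have "\<dots> \<le> k"
    using card_image_le[of "{..<k}" "\<lambda>i. A *v f i"] by simp
  finally have "dim ((\<lambda>i. A *v f i) ` {..<k}) < DIM(real^'n)"
    using k by simp
  then obtain x0 where x0: "x0 \<noteq> 0" "\<And>y. y \<in> span ((\<lambda>i. A *v f i) ` {..<k}) \<Longrightarrow> orthogonal x0 y"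
    using orthogonal_to_subspace_exists by blast
  have "x0 \<in> U"
    using x0(2) by (auto simp: U_def orthogonal_def intro: span_base)
  define K where "K = U \<inter> sphere 0 1"
  have "x0 /\<^sub>R norm x0 \<in> K"
    using \<open>x0 \<in> U\<close> x0(1) by (simp add: K_def U_def)
  moreover have "compact K"
  proof -
    have "U = (\<Inter>i\<in>{..<k}. {x. x \<bullet> (A *v f i) = 0})"
      by (auto simp: U_def)
    moreover have "closed {x. x \<bullet> (A *v f i) = 0}" for i
      by (intro closed_Collect_eq continuous_intros)
    ultimately have "closed U"
      by auto
    then show ?thesis
      by (simp add: K_def closed_Int_compact)
  qed
  moreover have "continuous_on K (\<lambda>x. (x \<bullet> (B *v x)) / (x \<bullet> (A *v x)))"
  proof (intro continuous_intros)
    show "\<forall>x\<in>K. x \<bullet> (A *v x) \<noteq> 0"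
    proof
      fix x assume "x \<in> K"
      then have "x \<noteq> 0" by (auto simp: K_def)
      from Apos[OF this] show "x \<bullet> (A *v x) \<noteq> 0" by simp
    qed
  qed
  ultimately obtain w where w: "w \<in> K"
    and w_max: "\<And>x. x \<in> K \<Longrightarrow> (x \<bullet> (B *v x)) / (x \<bullet> (A *v x)) \<le> (w \<bullet> (B *v w)) / (w \<bullet> (A *v w))"
    using continuous_attains_sup[of K] by blast
  define c where "c = (w \<bullet> (B *v w)) / (w \<bullet> (A *v w))"
  have "w \<in> U" "w \<noteq> 0" using w by (auto simp: K_def)
  \<comment> \<open>Subtracting the maximal quotient \<open>c\<close> yields a form that is
    nonpositive on \<open>U\<close> and vanishes at \<open>w\<close>, so that \<open>w\<close>
    maximizes it on \<open>U\<close>.\<close>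
  define C where "C = B - c *\<^sub>R A"
  have C_apply: "C *v x = B *v x - c *\<^sub>R (A *v x)" for x
    by (simp add: C_def matrix_vector_mult_diff_rdistrib scaleR_matrix_vector_assoc)
  have Ct: "x \<bullet> (C *v y) = y \<bullet> (C *v x)" for x y
    unfolding C_apply inner_diff_right inner_scaleR_right
    using symmetric_inner_mult[OF At, of x y] symmetric_inner_mult[OF B, of x y] by simp
  have C_w: "w \<bullet> (C *v w) = 0"
    using Apos[OF \<open>w \<noteq> 0\<close>] by (simp add: C_apply inner_diff_right c_def)
  have C_U: "x \<bullet> (C *v x) \<le> 0" if "x \<in> U" for x
  proof (cases "x = 0")
    case False
    have "x /\<^sub>R norm x \<in> K"
      using that False by (simp add: K_def U_def)
    from w_max[OF this] have "(x \<bullet> (B *v x)) / (x \<bullet> (A *v x)) \<le> c"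
      using False by (simp add: c_def matrix_vector_mult_scaleR divide_simps)
    then show ?thesis
      using Apos[OF False] by (simp add: C_apply inner_diff_right divide_simps)
  qed simp
  \<comment> \<open>First variation at the maximizer of the Rayleigh quotient.\<close>
  have C_Uw: "u \<bullet> (C *v w) = 0" if "u \<in> U" for u
  proof (rule ccontr)
    assume nz: "u \<bullet> (C *v w) \<noteq> 0"
    define a where "a = u \<bullet> (C *v w)"
    define b where "b = u \<bullet> (C *v u)"
    have ineq: "2 * t * a + t\<^sup>2 * b \<le> 0" for t
    proof -
      have "(w + t *\<^sub>R u) \<bullet> (C *v (w + t *\<^sub>R u)) = 2 * t * a + t\<^sup>2 * b"
        using C_w Ct[of w u]
        by (simp add: matrix_vector_right_distrib matrix_vector_mult_scaleR inner_add_left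
            inner_add_right a_def b_def power2_eq_square algebra_simps)
      then show ?thesis
        using C_U[OF U_comb[OF \<open>w \<in> U\<close> that, of t]] by simp
    qed
    have "b \<le> 0" using C_U[OF that] by (simp add: b_def)
    \<comment> \<open>Since b \<le> 0, this \<open>t\<close> is well defined and turns 2ta + t^2 b
      into t^2 (2 - b), which is positive.\<close>
    define t where "t = a / (1 - b)"
    have "a = t * (1 - b)"
      using \<open>b \<le> 0\<close> by (simp add: t_def)
    have "2 * t * a + t\<^sup>2 * b = t\<^sup>2 * (2 - b)"
      unfolding \<open>a = t * (1 - b)\<close> by (simp add: algebra_simps power2_eq_square)
    moreover have "0 < t\<^sup>2 * (2 - b)"
      using \<open>b \<le> 0\<close> nz by (simp add: t_def a_def)
    ultimately show False
      using ineq[of t] by simp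
  qed
  have fw: "f i \<bullet> (A *v w) = 0" if "i < k" for i
    using \<open>w \<in> U\<close> that symmetric_inner_mult[OF At, of "f i" w] by (simp add: U_def)
  have "f i \<bullet> (C *v w) = 0" if "i < k" for i
    using \<open>w \<in> U\<close> that eig[OF that] Ct[of "f i" w] by (simp add: U_def C_apply inner_diff_right)
  have "x \<bullet> (C *v w) = 0" for x
  proof -
    \<comment> \<open>This is the \<open>A\<close>-orthogonal projection of \<open>x\<close> onto
      the span of the earlier vectors, so the remainder lies in \<open>U\<close>.\<close>
    define s where "s = (\<Sum>i<k. (x \<bullet> (A *v f i)) *\<^sub>R f i)"
    have "s \<bullet> (A *v f j) = x \<bullet> (A *v f j)" if "j < k" for j
    proof -
      have "s \<bullet> (A *v f j) = (\<Sum>i<k. (x \<bullet> (A *v f i)) * (if i = j then 1 else 0))"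
        unfolding s_def inner_sum_left by (intro sum.cong) (simp_all add: orth that)
      then show ?thesis
        using that by (simp add: if_distrib cong: if_cong)
    qed
    then have "x - s \<in> U"
      by (simp add: U_def inner_diff_left)
    moreover have "s \<bullet> (C *v w) = 0"
      unfolding s_def inner_sum_left
      using \<open>\<And>i. i < k \<Longrightarrow> f i \<bullet> (C *v w) = 0\<close> by simp
    ultimately show ?thesis
      using C_Uw[of "x - s"] by (simp add: inner_diff_left)
  qed
  then have "C *v w = 0"
    using inner_eq_zero_iff by blast
  then have Bw: "B *v w = c *\<^sub>R (A *v w)"
    by (simp add: C_apply)
  define r where "r = sqrt (w \<bullet> (A *v w))"
  have r: "r > 0" "r * r = w \<bullet> (A *v w)"
    using Apos[OF \<open>w \<noteq> 0\<close>] by (simp_all add: r_def)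
  show ?thesis
  proof (rule that[of "w /\<^sub>R r" c])
    show "(w /\<^sub>R r) \<bullet> (A *v (w /\<^sub>R r)) = 1"
      using r(1) by (simp add: matrix_vector_mult_scaleR flip: r(2)) (simp add: field_simps)
    show "f i \<bullet> (A *v (w /\<^sub>R r)) = 0" if "i < k" for i
      using fw[OF that] by (simp add: matrix_vector_mult_scaleR)
    show "B *v (w /\<^sub>R r) = c *\<^sub>R (A *v (w /\<^sub>R r))"
      by (simp add: matrix_vector_mult_scaleR Bw)
  qed
qed

text \<open>Indexing by naturals lets the induction run over the number of vectors; the passage to
  the index type \<open>'n\<close> is left to \<open>simultaneous_diagonalization\<close>.\<close>

lemma generalized_eigenvectors:
  fixes A B :: "real^'n^'n"
  assumes A: "A \<in> posdef_matrices" and B: "transpose B = B"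
  shows "k \<le> CARD('n) \<Longrightarrow> \<exists>(f :: nat \<Rightarrow> real^'n) l.
    (\<forall>i<k. \<forall>j<k. f i \<bullet> (A *v f j) = (if i = j then 1 else 0)) \<and>
    (\<forall>i<k. B *v f i = l i *\<^sub>R (A *v f i))"
proof (induction k)
  case (Suc k)
  then obtain f :: "nat \<Rightarrow> real^'n" and l where
    f: "\<And>i j. i < k \<Longrightarrow> j < k \<Longrightarrow> f i \<bullet> (A *v f j) = (if i = j then 1 else 0)"
    "\<And>i. i < k \<Longrightarrow> B *v f i = l i *\<^sub>R (A *v f i)"
    by auto
  obtain w c where w: "w \<bullet> (A *v w) = 1" "\<And>i. i < k \<Longrightarrow> f i \<bullet> (A *v w) = 0"
    "B *v w = c *\<^sub>R (A *v w)"
    using generalized_eigenvector_step[OF A B _ f, of k] Suc.prems by (auto simp: Suc_le_eq)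
  have "w \<bullet> (A *v f i) = 0" if "i < k" for i
    using w(2)[OF that] symmetric_inner_mult[of A w "f i"] A by (simp add: posdef_matrices_def)
  then show ?case
    using f w by (intro exI[of _ "f(k := w)"] exI[of _ "l(k := c)"]) (auto simp: less_Suc_eq)
qed simp

lemma congruence_entry:
  fixes A R :: "real^'n^'n"
  shows "(transpose R ** A ** R) $ i $ j = column i R \<bullet> (A *v column j R)"
  unfolding matrix_mul_assoc[symmetric]
  by (simp add: matrix_matrix_mult_def transpose_def column_def inner_vec_def matrix_vector_mult_def)

text \<open>The columns of \<open>R\<close> are the \<open>A\<close>-orthonormal generalized
  eigenvectors of \<open>B\<close>. With \<open>A = mat 1\<close> this is the spectral theorem, the
  form in which \<open>det_kron_symmetric\<close> uses it.\<close>

theorem simultaneous_diagonalization: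
  fixes A B :: "real^'n^'n"
  assumes "A \<in> posdef_matrices" "transpose B = B"
  obtains R :: "real^'n^'n" and d where "transpose R ** A ** R = mat 1"
    "transpose R ** B ** R = (\<chi> i j. if i = j then d i else 0)"
proof -
  obtain f :: "nat \<Rightarrow> real^'n" and l where
    f: "\<And>i j. i < CARD('n) \<Longrightarrow> j < CARD('n) \<Longrightarrow> f i \<bullet> (A *v f j) = (if i = j then 1 else 0)"
    "\<And>i. i < CARD('n) \<Longrightarrow> B *v f i = l i *\<^sub>R (A *v f i)"
    using generalized_eigenvectors[OF assms, of "CARD('n)"] by auto
  obtain e :: "'n \<Rightarrow> nat" where "bij_betw e UNIV {0..<CARD('n)}"
    using ex_bij_betw_finite_nat[of "UNIV :: 'n set"] by auto
  then have e: "\<And>i. e i < CARD('n)" "inj e"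
    by (auto simp: bij_betw_def)
  define R :: "real^'n^'n" where "R = (\<chi> i j. f (e j) $ i)"
  have col: "column j R = f (e j)" for j
    by (simp add: R_def column_def vec_eq_iff)
  show ?thesis
  proof (rule that[of R "\<lambda>i. l (e i)"])
    show "transpose R ** A ** R = mat 1"
      using e by (auto simp: vec_eq_iff congruence_entry col f mat_def inj_eq)
    show "transpose R ** B ** R = (\<chi> i j. if i = j then l (e i) else 0)"
      using e by (auto simp: vec_eq_iff congruence_entry col f inj_eq)
  qed
qed

section \<open>Determinants, inverses and Kronecker products\<close>

lemma sum_UNIV_pair:
  fixes f :: "'a::finite \<times> 'b::finite \<Rightarrow> 'c::comm_monoid_add"
  shows "(\<Sum>p\<in>UNIV. f p) = (\<Sum>i\<in>UNIV. \<Sum>j\<in>UNIV. f (i, j))"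
proof -
  have "(\<Sum>i\<in>UNIV. \<Sum>j\<in>UNIV. f (i, j)) = (\<Sum>p\<in>UNIV \<times> UNIV. case p of (i, j) \<Rightarrow> f (i, j))"
    by (rule sum.cartesian_product)
  then show ?thesis
    by simp
qed

lemma prod_UNIV_pair:
  fixes f :: "'a::finite \<times> 'b::finite \<Rightarrow> 'c::comm_monoid_mult"
  shows "(\<Prod>p\<in>UNIV. f p) = (\<Prod>i\<in>UNIV. \<Prod>j\<in>UNIV. f (i, j))"
proof -
  have "(\<Prod>i\<in>UNIV. \<Prod>j\<in>UNIV. f (i, j)) = (\<Prod>p\<in>UNIV \<times> UNIV. case p of (i, j) \<Rightarrow> f (i, j))"
    by (rule prod.cartesian_product)
  then show ?thesis
    by simp
qed

lemma matrix_inv_unique: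
  fixes A B :: "real^'n^'n"
  assumes "A ** B = mat 1"
  shows "matrix_inv A = B"
proof -
  have BA: "B ** A = mat 1"
    using assms matrix_left_right_inverse by blast
  then have "A ** matrix_inv A = mat 1 \<and> matrix_inv A ** A = mat 1"
    unfolding matrix_inv_def using assms by (metis (mono_tags, lifting) someI)
  then have "B ** (A ** matrix_inv A) = B"
    by (metis matrix_mul_rid)
  then show ?thesis
    unfolding matrix_mul_assoc BA by (metis matrix_mul_lid)
qed

lemma matrix_inv_mult:
  fixes A :: "real^'n^'n"
  assumes "det A \<noteq> 0"
  shows "A ** matrix_inv A = mat 1" "matrix_inv A ** A = mat 1"
proof -
  obtain B where "A ** B = mat 1"
    using assms invertible_det_nz[of A] by (auto simp: invertible_def)
  then show "A ** matrix_inv A = mat 1" "matrix_inv A ** A = mat 1"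
    using matrix_inv_unique matrix_left_right_inverse by metis+
qed

lemma det_matrix_inv:
  fixes A :: "real^'n^'n"
  assumes "det A \<noteq> 0"
  shows "det (matrix_inv A) = 1 / det A"
  using arg_cong[OF matrix_inv_mult(1)[OF assms], of det] assms by (simp add: det_mul field_simps)

lemma transpose_matrix_inv:
  fixes A :: "real^'n^'n"
  assumes "det A \<noteq> 0"
  shows "transpose (matrix_inv A) = matrix_inv (transpose A)"
  by (rule matrix_inv_unique[symmetric])
    (simp flip: matrix_transpose_mul add: matrix_inv_mult[OF assms])

lemma matrix_inv_scaleR:
  fixes A :: "real^'n^'n"
  assumes "det A \<noteq> 0" "c \<noteq> 0"
  shows "matrix_inv (c *\<^sub>R A) = (1 / c) *\<^sub>R matrix_inv A"
  by (rule matrix_inv_unique)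
    (simp add: matrix_scalar_ac matrix_inv_mult[OF assms(1)] assms(2) flip: scalar_matrix_assoc)

lemma det_scaleR:
  fixes A :: "real^'n^'n"
  shows "det (c *\<^sub>R A) = c ^ CARD('n) * det A"
proof -
  have "c *\<^sub>R A = matrix ((*\<^sub>R) c) ** A"
    by (simp add: matrix_scaleR matrix_matrix_mult_def mat_def vec_eq_iff if_distrib if_distribR
        cong: if_cong)
  then show ?thesis
    by (simp add: det_mul)
qed

section \<open>Positive definite matrices\<close>

lemma posdef_symmetric: "A \<in> posdef_matrices \<Longrightarrow> transpose A = A"
  by (simp add: posdef_matrices_def)

lemma mat_1_posdef: "mat 1 \<in> posdef_matrices"
  by (simp add: posdef_matrices_def)

text \<open>Congruence to the identity gives (det R)^2 det A = 1.\<close>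

lemma posdef_det_pos:
  fixes A :: "real^'n^'n"
  assumes "A \<in> posdef_matrices"
  shows "0 < det A"
proof -
  obtain R :: "real^'n^'n" where "transpose R ** A ** R = mat 1"
    using simultaneous_diagonalization[OF assms posdef_symmetric[OF assms]] by blast
  from arg_cong[OF this, of det] have *: "(det R)\<^sup>2 * det A = 1"
    by (simp add: det_mul power2_eq_square mult_ac)
  show ?thesis
    using mult_nonneg_nonpos[OF zero_le_power2, of "det A" "det R"] * by force
qed

lemma posdef_congruence:
  fixes A Q :: "real^'n^'n"
  assumes "A \<in> posdef_matrices" "det Q \<noteq> 0"
  shows "transpose Q ** A ** Q \<in> posdef_matrices"
  unfolding posdef_matrices_def
proof (intro CollectI conjI allI impI)
  show "transpose (transpose Q ** A ** Q) = transpose Q ** A ** Q"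
    by (simp add: matrix_transpose_mul posdef_symmetric[OF assms(1)] matrix_mul_assoc)
  fix x :: "real^'n" assume "x \<noteq> 0"
  have "x = matrix_inv Q *v (Q *v x)"
    by (simp add: matrix_vector_mul_assoc matrix_inv_mult[OF assms(2)])
  then have "Q *v x \<noteq> 0"
    using \<open>x \<noteq> 0\<close> by force
  moreover have "x \<bullet> (transpose Q ** A ** Q *v x) = (Q *v x) \<bullet> (A *v (Q *v x))"
    unfolding matrix_vector_mul_assoc[symmetric]
    by (subst dot_lmul_matrix[symmetric]) (simp only: vector_transpose_matrix)
  ultimately show "0 < x \<bullet> (transpose Q ** A ** Q *v x)"
    using assms(1) by (simp add: posdef_matrices_def)
qed

text \<open>By symmetry, the inverse of \<open>A\<close> is the congruence of \<open>A\<close> by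
  \<open>matrix_inv A\<close>.\<close>

lemma posdef_matrix_inv:
  fixes A :: "real^'n^'n"
  assumes "A \<in> posdef_matrices"
  shows "matrix_inv A \<in> posdef_matrices"
proof -
  have nz: "det A \<noteq> 0"
    using posdef_det_pos[OF assms] by simp
  have "transpose (matrix_inv A) ** A ** matrix_inv A \<in> posdef_matrices"
    by (rule posdef_congruence[OF assms]) (simp add: det_matrix_inv nz)
  then show ?thesis
    by (simp add: transpose_matrix_inv nz posdef_symmetric[OF assms] matrix_inv_mult)
qed

lemma posdef_scaleR: "A \<in> posdef_matrices \<Longrightarrow> 0 < c \<Longrightarrow> c *\<^sub>R A \<in> posdef_matrices"
  by (simp add: posdef_matrices_def transpose_scalar flip: scaleR_matrix_vector_assoc)

lemma posdiag_posdef: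
  fixes D :: "real^'n^'n"
  assumes "D \<in> posdiag_matrices"
  shows "D \<in> posdef_matrices"
  unfolding posdef_matrices_def
proof (intro CollectI conjI allI impI)
  have off: "D $ i $ j = 0" if "i \<noteq> j" for i j
    using assms that by (simp add: posdiag_matrices_def)
  have pos: "0 < D $ i $ i" for i
    using assms by (simp add: posdiag_matrices_def)
  show "transpose D = D"
    unfolding transpose_def vec_eq_iff vec_lambda_beta
  proof (intro allI)
    show "D $ j $ i = D $ i $ j" for i j
      by (cases "i = j") (auto simp: off)
  qed
  fix x :: "real^'n" assume "x \<noteq> 0"
  have "(\<Sum>j\<in>UNIV. D $ i $ j * x $ j) = (\<Sum>j\<in>UNIV. if j = i then D $ i $ i * x $ i else 0)" for i
    by (intro sum.cong) (auto simp: off)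
  then have "x \<bullet> (D *v x) = (\<Sum>i\<in>UNIV. D $ i $ i * (x $ i)\<^sup>2)"
    by (simp add: inner_vec_def matrix_vector_mult_def power2_eq_square mult_ac)
  also have "\<dots> > 0"
  proof -
    obtain i where "x $ i \<noteq> 0"
      using \<open>x \<noteq> 0\<close> by (auto simp: vec_eq_iff)
    then show ?thesis
      using pos by (intro sum_pos2[of _ i]) (auto simp: less_imp_le)
  qed
  finally show "0 < x \<bullet> (D *v x)" .
qed

text \<open>In coordinates where \<open>S\<close> is the identity and \<open>C\<close> is diagonal
  with entries \<open>d i\<close>, the trace is the sum of the \<open>d i\<close> and det C / det S
  is their product. Both claims then reduce to single positive numbers.\<close>

lemma trace_posdef_quotient:
  fixes S C :: "real^'n^'n"
  assumes S: "S \<in> posdef_matrices" and C: "C \<in> posdef_matrices"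
  shows "0 < trace (C ** matrix_inv S)" (is ?pos)
    and "ln (det C) - ln (det S) \<le>
      trace (C ** matrix_inv S) / CARD('n) - CARD('n) + CARD('n) * ln (CARD('n))" (is ?ineq)
proof -
  let ?n = "real CARD('n)"
  obtain R :: "real^'n^'n" and d where
    RS: "transpose R ** S ** R = mat 1" and
    RC: "transpose R ** C ** R = (\<chi> i j. if i = j then d i else 0)"
    using simultaneous_diagonalization[OF S posdef_symmetric[OF C]] by blast
  have detS: "(det R)\<^sup>2 * det S = 1"
    using arg_cong[OF RS, of det] by (simp add: det_mul power2_eq_square mult_ac)
  then have "det R \<noteq> 0" by auto
  have "transpose R ** C ** R \<in> posdef_matrices"
    by (rule posdef_congruence[OF C \<open>det R \<noteq> 0\<close>])
  then have "0 < axis i 1 \<bullet> ((transpose R ** C ** R) *v axis i 1)" for i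
    by (simp add: posdef_matrices_def axis_eq_0_iff)
  then have d: "0 < d i" for i
    by (simp add: RC matrix_vector_mul_component inner_axis' matrix_vector_mult_basis column_def)
  \<comment> \<open>From R^t S R = I the inverse of \<open>S\<close> is R R^t.\<close>
  have "S ** (R ** transpose R) = mat 1"
    using RS by (metis matrix_left_right_inverse matrix_mul_assoc)
  from matrix_inv_unique[OF this]
  have "trace (C ** matrix_inv S) = trace (C ** R ** transpose R)"
    by (simp add: matrix_mul_assoc)
  also have "\<dots> = trace (transpose R ** C ** R)"
    by (metis matrix_mul_assoc trace_mul_sym)
  also have "\<dots> = (\<Sum>i\<in>UNIV. d i)"
    by (simp add: RC trace_def)
  finally have tr: "trace (C ** matrix_inv S) = (\<Sum>i\<in>UNIV. d i)" .
  show ?pos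
    unfolding tr by (intro sum_pos) (auto simp: d)
  have "(det R)\<^sup>2 * det C = (\<Prod>i\<in>UNIV. d i)"
    using arg_cong[OF RC, of det] by (simp add: det_mul power2_eq_square mult_ac det_diagonal)
  then have "det C / det S = (\<Prod>i\<in>UNIV. d i)"
    using detS posdef_det_pos[OF S] by (simp add: divide_simps) (metis mult.commute mult.left_commute mult_1)
  moreover have "ln (det C) - ln (det S) = ln (det C / det S)"
    using posdef_det_pos[OF C] posdef_det_pos[OF S] by (rule ln_divide_pos[symmetric])
  ultimately have "ln (det C) - ln (det S) = ln (\<Prod>i\<in>UNIV. d i)"
    by (simp only:)
  also have "\<dots> = (\<Sum>i\<in>UNIV. ln (d i))"
    by (rule ln_prod) (use d in \<open>auto simp: less_le\<close>)
  also have "\<dots> \<le> (\<Sum>i\<in>UNIV. d i / ?n - 1 + ln ?n)"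
  proof (rule sum_mono)
    fix i
    \<comment> \<open>Dividing by n makes the bound sharp at \<open>d i = n\<close>, the value taken
      at the maximizer over \<Omega>.\<close>
    have "ln (d i / ?n) \<le> d i / ?n - 1"
      by (rule ln_le_minus_one) (simp add: d)
    then show "ln (d i) \<le> d i / ?n - 1 + ln ?n"
      using d[of i] by (simp add: ln_divide_pos)
  qed
  also have "\<dots> = (\<Sum>i\<in>UNIV. d i) / ?n - ?n + ?n * ln ?n"
    by (simp add: sum.distrib sum_subtractf sum_divide_distrib)
  finally show ?ineq
    by (simp add: tr)
qed

section \<open>Kronecker products and their quadratic forms\<close>

lemma kron_mult: "kron A B ** kron C D = kron (A ** C) (B ** D)"
proof -
  have "(\<Sum>k\<in>UNIV. A $ i $ fst k * B $ j $ snd k * (C $ fst k $ i' * D $ snd k $ j')) =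
    (\<Sum>k\<in>UNIV. A $ i $ k * C $ k $ i') * (\<Sum>k\<in>UNIV. B $ j $ k * D $ k $ j')" for i j i' j'
    by (simp add: sum_UNIV_pair sum_product mult_ac)
  then show ?thesis
    by (simp add: kron_def matrix_matrix_mult_def vec_eq_iff)
qed

lemma kron_mat_1: "kron (mat 1) (mat 1) = mat 1"
  by (auto simp: kron_def mat_def vec_eq_iff prod_eq_iff)

lemma transpose_kron: "transpose (kron A B) = kron (transpose A) (transpose B)"
  by (simp add: kron_def transpose_def vec_eq_iff)

lemma scaleR_kron: "c *\<^sub>R kron A B = kron A (c *\<^sub>R B)"
  by (simp add: kron_def vec_eq_iff)

lemma matrix_inv_kron:
  assumes "det A \<noteq> 0" "det B \<noteq> 0"
  shows "matrix_inv (kron A B) = kron (matrix_inv A) (matrix_inv B)"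
  by (rule matrix_inv_unique) (simp add: kron_mult matrix_inv_mult assms kron_mat_1)

lemma det_orthogonal_congruence:
  fixes R X :: "real^'n^'n"
  assumes "transpose R ** R = mat 1"
  shows "det (transpose R ** X ** R) = det X"
proof -
  have "det R * det R = 1"
    using arg_cong[OF assms, of det] by (simp add: det_mul)
  moreover have "det (transpose R ** X ** R) = (det R * det R) * det X"
    by (simp add: det_mul)
  ultimately show ?thesis
    by simp
qed

text \<open>Orthogonal diagonalization of both factors reduces the determinant to the diagonal case.\<close>

lemma det_kron_symmetric:
  fixes A :: "real^'m^'m" and B :: "real^'n^'n"
  assumes "transpose A = A" "transpose B = B"
  shows "det (kron A B) = det A ^ CARD('n) * det B ^ CARD('m)"
proof -
  obtain P :: "real^'m^'m" and a where P: "transpose P ** P = mat 1"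
    and PA: "transpose P ** A ** P = (\<chi> i j. if i = j then a i else 0)"
    by (rule simultaneous_diagonalization[OF mat_1_posdef assms(1), unfolded matrix_mul_rid])
  obtain Q :: "real^'n^'n" and b where Q: "transpose Q ** Q = mat 1"
    and QB: "transpose Q ** B ** Q = (\<chi> i j. if i = j then b i else 0)"
    by (rule simultaneous_diagonalization[OF mat_1_posdef assms(2), unfolded matrix_mul_rid])
  have orth: "transpose (kron P Q) ** kron P Q = mat 1"
    by (simp add: transpose_kron kron_mult P Q kron_mat_1)
  have "det (kron A B) = det (transpose (kron P Q) ** kron A B ** kron P Q)"
    by (rule det_orthogonal_congruence[OF orth, symmetric])
  also have "transpose (kron P Q) ** kron A B ** kron P Q =
      kron (transpose P ** A ** P) (transpose Q ** B ** Q)"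
    by (simp add: transpose_kron kron_mult)
  also have "det \<dots> = (\<Prod>p\<in>UNIV. a (fst p) * b (snd p))"
    unfolding PA QB kron_def by (subst det_diagonal) (auto simp: prod_eq_iff)
  also have "\<dots> = (\<Prod>i\<in>UNIV. a i) ^ CARD('n) * (\<Prod>j\<in>UNIV. b j) ^ CARD('m)"
    by (simp add: prod_UNIV_pair prod.distrib prod_power_distrib)
  also have "(\<Prod>i\<in>UNIV. a i) = det A"
    using det_orthogonal_congruence[OF P, of A] unfolding PA by (simp add: det_diagonal)
  also have "(\<Prod>j\<in>UNIV. b j) = det B"
    using det_orthogonal_congruence[OF Q, of B] unfolding QB by (simp add: det_diagonal)
  finally show ?thesis .
qed

lemma inner_vec_of: "vec_of X \<bullet> vec_of Y = trace (transpose X ** Y)"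
proof -
  have "vec_of X \<bullet> vec_of Y = (\<Sum>p\<in>UNIV. X $ snd p $ fst p * Y $ snd p $ fst p)"
    by (simp add: inner_vec_def vec_of_def)
  also have "\<dots> = (\<Sum>i\<in>UNIV. \<Sum>j\<in>UNIV. X $ j $ i * Y $ j $ i)"
    by (simp add: sum_UNIV_pair)
  finally show ?thesis
    by (simp add: trace_def matrix_matrix_mult_def transpose_def)
qed

text \<open>The identity vec(A Y B^t) = (B \<otimes> A) vec Y turns the form into a Frobenius inner
  product, which is a trace.\<close>

lemma quadratic_form_kron:
  fixes S1 S2 Y :: "real^'m^'m"
  assumes "S1 \<in> posdef_matrices" "S2 \<in> posdef_matrices"
  shows "vec_of Y \<bullet> (matrix_inv (kron S2 S1) *v vec_of Y) =
    trace (transpose Y ** matrix_inv S1 ** Y ** matrix_inv S2)"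
proof -
  have nz: "det S1 \<noteq> 0" "det S2 \<noteq> 0"
    using assms posdef_det_pos by (metis less_irrefl)+
  have "vec_of Y \<bullet> (matrix_inv (kron S2 S1) *v vec_of Y) =
      vec_of Y \<bullet> vec_of (matrix_inv S1 ** Y ** transpose (matrix_inv S2))"
    by (simp add: matrix_inv_kron nz vec_of_matrix_triple_product)
  also have "\<dots> = trace (transpose Y ** (matrix_inv S1 ** Y ** matrix_inv S2))"
    by (simp add: inner_vec_of transpose_matrix_inv nz posdef_symmetric[OF assms(2)])
  finally show ?thesis
    by (simp add: matrix_mul_assoc)
qed

section \<open>Likelihoods over a cone\<close>

text \<open>Twice the negative normal log-likelihood, with the constant m^2 ln(2 pi) dropped; normal
  maximizers become its minimizers.\<close>

definition neg_loglik :: "real^'m^'m \<Rightarrow> real^('m::finite \<times> 'm)^('m \<times> 'm) \<Rightarrow> real" where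
  "neg_loglik Y V = ln (det V) + vec_of Y \<bullet> (matrix_inv V *v vec_of Y)"

lemma normal_lik_le_iff:
  fixes Y :: "real^'m^'m"
  assumes "0 < det V" "0 < det V'"
  shows "normal_lik Y V \<le> normal_lik Y V' \<longleftrightarrow> neg_loglik Y V' \<le> neg_loglik Y V"
proof -
  have eq: "normal_lik Y U =
      (2 * pi) powr (- (real CARD('m))\<^sup>2 / 2) * exp (- (neg_loglik Y U / 2))"
    if "0 < det U" for U
    using that by (simp add: normal_lik_def neg_loglik_def powr_def add_divide_distrib exp_add[symmetric])
  show ?thesis
    using assms by (simp add: eq)
qed

lemma normal_lik_arg_max_iff:
  assumes "\<And>V. V \<in> W \<Longrightarrow> 0 < det V"
  shows "is_arg_max (normal_lik Y) (\<lambda>V. V \<in> W) V \<longleftrightarrow>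
    V \<in> W \<and> (\<forall>V'\<in>W. neg_loglik Y V \<le> neg_loglik Y V')"
  unfolding is_arg_max_linorder using normal_lik_le_iff[OF assms assms] by blast

lemma quadratic_form_scaleR:
  fixes V :: "real^'k^'k"
  assumes "det V \<noteq> 0" "c \<noteq> 0"
  shows "y \<bullet> (matrix_inv (c *\<^sub>R V) *v y) = (y \<bullet> (matrix_inv V *v y)) / c"
  by (simp add: matrix_inv_scaleR assms flip: scaleR_matrix_vector_assoc)

lemma ln_det_scaleR:
  fixes V :: "real^('m::finite \<times> 'm)^('m \<times> 'm)"
  assumes "0 < det V" "0 < c"
  shows "ln (det (c *\<^sub>R V)) = (real CARD('m))\<^sup>2 * ln c + ln (det V)"
  using assms by (simp add: det_scaleR ln_mult ln_realpow power2_eq_square)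

lemma neg_loglik_scaleR:
  fixes V :: "real^('m::finite \<times> 'm)^('m \<times> 'm)"
  assumes "0 < det V" "0 < c"
  shows "neg_loglik Y (c *\<^sub>R V) =
    (real CARD('m))\<^sup>2 * ln c + ln (det V) + (vec_of Y \<bullet> (matrix_inv V *v vec_of Y)) / c"
  using assms by (simp add: neg_loglik_def ln_det_scaleR quadratic_form_scaleR)

text \<open>These three assumptions are what \<Omega> and \<omega> share, so the comparison of the
  two likelihoods is carried out once for both.\<close>

context
  fixes Y :: "real^'m^'m" and W :: "(real^('m::finite \<times> 'm)^('m \<times> 'm)) set" and n :: real
  defines "n \<equiv> (real CARD('m))\<^sup>2"
  assumes det_pos: "\<And>V. V \<in> W \<Longrightarrow> 0 < det V"
    and quad_pos: "\<And>V. V \<in> W \<Longrightarrow> 0 < vec_of Y \<bullet> (matrix_inv V *v vec_of Y)"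
    and cone: "\<And>V c. V \<in> W \<Longrightarrow> 0 < c \<Longrightarrow> c *\<^sub>R V \<in> W"
begin

lemma card_sq_pos: "0 < n"
  by (simp add: n_def)

text \<open>A minimizer over the cone also minimizes along its own ray. Comparison with one multiple
  yields q/n - 1 \<le> ln(q/n), which forces q/n = 1.\<close>

lemma normal_mle_quadratic_form:
  assumes "V \<in> W" "\<And>V'. V' \<in> W \<Longrightarrow> neg_loglik Y V \<le> neg_loglik Y V'"
  shows "vec_of Y \<bullet> (matrix_inv V *v vec_of Y) = n"
proof -
  let ?q = "vec_of Y \<bullet> (matrix_inv V *v vec_of Y)"
  have q: "0 < ?q" "0 < ?q / n"
    using quad_pos[OF assms(1)] card_sq_pos by auto
  \<comment> \<open>The factor q/n is the minimizer of c \<mapsto> n ln c + q/c.\<close>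
  have "neg_loglik Y V \<le> neg_loglik Y ((?q / n) *\<^sub>R V)"
    using assms cone q by blast
  then have "?q \<le> n * ln (?q / n) + n"
    using q unfolding neg_loglik_scaleR[OF det_pos[OF assms(1)] q(2)]
    by (simp add: neg_loglik_def n_def)
  then have "?q / n - 1 \<le> ln (?q / n)"
    using card_sq_pos by (simp add: field_simps)
  then have "?q / n = 1"
    using ln_eq_minus_one[OF q(2)] ln_le_minus_one[OF q(2)] by simp
  then show ?thesis
    using card_sq_pos by simp
qed

text \<open>\<open>det V powr (- 1 / 2) * q powr (- n / 2)\<close>, with \<open>q\<close> the quadratic form at \<open>V\<close>, is
  invariant under scaling of \<open>V\<close>; rescaling to \<open>q = n\<close> bounds it by its value at the normal MLE.\<close>

lemma scale_invariant_bound: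
  assumes V: "V \<in> W" "\<And>V'. V' \<in> W \<Longrightarrow> neg_loglik Y V \<le> neg_loglik Y V'" and V': "V' \<in> W"
  shows "ln (det V) + n * ln n \<le> ln (det V') + n * ln (vec_of Y \<bullet> (matrix_inv V' *v vec_of Y))"
proof -
  let ?q = "vec_of Y \<bullet> (matrix_inv V' *v vec_of Y)"
  have q: "0 < ?q" "0 < ?q / n"
    using quad_pos[OF V'] card_sq_pos by auto
  have "neg_loglik Y V \<le> neg_loglik Y ((?q / n) *\<^sub>R V')"
    using V cone[OF V'] q by blast
  moreover have "neg_loglik Y V = ln (det V) + n"
    using normal_mle_quadratic_form[OF V] by (simp add: neg_loglik_def)
  moreover have "neg_loglik Y ((?q / n) *\<^sub>R V') = n * ln (?q / n) + ln (det V') + n"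
    unfolding neg_loglik_scaleR[OF det_pos[OF V'] q(2)] using q by (simp add: n_def)
  moreover have "ln (?q / n) = ln ?q - ln n"
    using q(1) card_sq_pos by (rule ln_divide_pos)
  ultimately show ?thesis
    by (simp add: algebra_simps)
qed

context
  fixes h :: "real \<Rightarrow> real" and x_h K :: real
  assumes h_nonneg: "\<And>x. 0 \<le> x \<Longrightarrow> 0 \<le> h x"
    and x_h_pos: "0 < x_h"
    and x_h_max: "is_arg_max (\<lambda>x. x powr (n / 2) * h x) (\<lambda>x. 0 \<le> x) x_h"
  defines "K \<equiv> x_h powr (n / 2) * h x_h"
begin

text \<open>Maximality at \<open>x_h\<close> gives h(q) \<le> K q^(-n/2). What remains is
  \<open>K\<close> times the scale invariant factor, which \<open>scale_invariant_bound\<close>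
  controls.\<close>

lemma elliptical_lik_bound:
  assumes V: "V \<in> W" "\<And>V'. V' \<in> W \<Longrightarrow> neg_loglik Y V \<le> neg_loglik Y V'" and V': "V' \<in> W"
  shows "elliptical_lik h Y V' \<le> K * exp (- ((ln (det V) + n * ln n) / 2))"
proof -
  let ?q = "vec_of Y \<bullet> (matrix_inv V' *v vec_of Y)"
  have q: "0 < ?q"
    by (rule quad_pos[OF V'])
  have "?q powr (n / 2) * h ?q \<le> K"
    using x_h_max q by (auto simp: is_arg_max_linorder K_def)
  then have "h ?q \<le> K * ?q powr (- (n / 2))"
    using q by (simp add: powr_minus field_simps)
  then have "elliptical_lik h Y V' \<le> det V' powr (- 1 / 2) * (K * ?q powr (- (n / 2)))"
    unfolding elliptical_lik_def by (intro mult_left_mono) simp_all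
  also have "\<dots> = K * exp (- ((ln (det V') + n * ln ?q) / 2))"
    using q det_pos[OF V'] by (simp add: powr_def exp_add[symmetric] add_divide_distrib)
  also have "\<dots> \<le> K * exp (- ((ln (det V) + n * ln n) / 2))"
    using scale_invariant_bound[OF V V'] h_nonneg[of x_h] x_h_pos
    by (intro mult_left_mono) (simp_all add: K_def)
  finally show ?thesis .
qed

text \<open>The factor n / x_h moves the quadratic form from n to \<open>x_h\<close>, where the
  bound on \<open>h\<close> is an equality; hence the value equals the upper bound of
  \<open>elliptical_lik_bound\<close>.\<close>

lemma elliptical_lik_rescaled_mle:
  assumes V: "V \<in> W" "\<And>V'. V' \<in> W \<Longrightarrow> neg_loglik Y V \<le> neg_loglik Y V'"
  shows "elliptical_lik h Y ((n / x_h) *\<^sub>R V) = K * exp (- ((ln (det V) + n * ln n) / 2))"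
proof -
  have c: "0 < n / x_h"
    using card_sq_pos x_h_pos by simp
  note d = det_pos[OF V(1)] det_pos[OF cone[OF V(1) c]]
  have "det ((n / x_h) *\<^sub>R V) powr (- 1 / 2) = exp (- ((n * ln (n / x_h) + ln (det V)) / 2))"
    using d by (simp add: powr_def ln_det_scaleR[OF d(1) c, folded n_def])
  also have "ln (n / x_h) = ln n - ln x_h"
    using card_sq_pos x_h_pos by (rule ln_divide_pos)
  also have "exp (- ((n * (ln n - ln x_h) + ln (det V)) / 2)) =
      x_h powr (n / 2) * exp (- ((ln (det V) + n * ln n) / 2))"
    using x_h_pos by (simp add: powr_def exp_add[symmetric] algebra_simps diff_divide_distrib add_divide_distrib)
  finally have "det ((n / x_h) *\<^sub>R V) powr (- 1 / 2) =
      x_h powr (n / 2) * exp (- ((ln (det V) + n * ln n) / 2))" .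
  moreover have "vec_of Y \<bullet> (matrix_inv ((n / x_h) *\<^sub>R V) *v vec_of Y) = x_h"
    using normal_mle_quadratic_form[OF V] c d card_sq_pos by (subst quadratic_form_scaleR) auto
  ultimately show ?thesis
    by (simp add: elliptical_lik_def K_def)
qed

text \<open>Bound and attained value coincide. In the resulting supremum only \<open>det V\<close>
  depends on the model, which is why \<open>h\<close> disappears from the likelihood ratio.\<close>

lemma elliptical_lik_mle:
  assumes V: "is_arg_max (normal_lik Y) (\<lambda>V. V \<in> W) V"
  shows "is_arg_max (elliptical_lik h Y) (\<lambda>V. V \<in> W) ((n / x_h) *\<^sub>R V)"
    and "(SUP V\<in>W. elliptical_lik h Y V) = K * exp (- ((ln (det V) + n * ln n) / 2))"
    and "bounded (elliptical_lik h Y ` W)"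
proof -
  have V': "V \<in> W" "\<And>V'. V' \<in> W \<Longrightarrow> neg_loglik Y V \<le> neg_loglik Y V'"
    using V normal_lik_arg_max_iff[of W Y V] det_pos by auto
  let ?M = "K * exp (- ((ln (det V) + n * ln n) / 2))"
  have mem: "(n / x_h) *\<^sub>R V \<in> W"
    using cone[OF V'(1)] card_sq_pos x_h_pos by simp
  have le: "elliptical_lik h Y U \<le> ?M" if "U \<in> W" for U
    by (rule elliptical_lik_bound[OF V' that])
  have eq: "elliptical_lik h Y ((n / x_h) *\<^sub>R V) = ?M"
    by (rule elliptical_lik_rescaled_mle[OF V'])
  show "is_arg_max (elliptical_lik h Y) (\<lambda>V. V \<in> W) ((n / x_h) *\<^sub>R V)"
    using mem le by (simp add: is_arg_max_linorder eq)
  show "(SUP V\<in>W. elliptical_lik h Y V) = ?M"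
  proof (rule cSup_eq_maximum)
    show "?M \<in> elliptical_lik h Y ` W"
      unfolding eq[symmetric] using mem by (rule imageI)
  qed (use le in auto)
  have "0 \<le> elliptical_lik h Y U" if "U \<in> W" for U
    using quad_pos[OF that] h_nonneg by (simp add: elliptical_lik_def)
  then show "bounded (elliptical_lik h Y ` W)"
    using le by (intro boundedI[of _ ?M]) auto
qed

end

end

section \<open>The normal likelihood over the full model\<close>

lemma det_kron_posdef:
  fixes S1 S2 :: "real^'m^'m"
  assumes "S1 \<in> posdef_matrices" "S2 \<in> posdef_matrices"
  shows "0 < det (kron S2 S1)"
    and "ln (det (kron S2 S1)) = CARD('m) * (ln (det S1) + ln (det S2))"
proof -
  have "det (kron S2 S1) = det S2 ^ CARD('m) * det S1 ^ CARD('m)"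
    by (rule det_kron_symmetric) (simp_all add: assms posdef_symmetric)
  moreover have "0 < det S1" "0 < det S2"
    by (simp_all add: posdef_det_pos assms)
  ultimately show "0 < det (kron S2 S1)"
    and "ln (det (kron S2 S1)) = CARD('m) * (ln (det S1) + ln (det S2))"
    by (simp_all add: ln_mult ln_realpow algebra_simps)
qed

lemma Omega_full_det_pos: "V \<in> Omega_full \<Longrightarrow> 0 < det V"
  by (auto simp: Omega_full_def det_kron_posdef)

lemma Omega_full_scaleR:
  assumes "V \<in> Omega_full" "0 < c"
  shows "c *\<^sub>R V \<in> Omega_full"
proof -
  obtain S1 S2 :: "real^'a^'a" where S: "V = kron S2 S1" "S1 \<in> posdef_matrices" "S2 \<in> posdef_matrices"
    using assms(1) by (auto simp: Omega_full_def)
  then have "c *\<^sub>R V = kron S2 (c *\<^sub>R S1)" "c *\<^sub>R S1 \<in> posdef_matrices"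
    using assms(2) by (simp_all add: scaleR_kron posdef_scaleR)
  then show ?thesis
    using S(3) unfolding Omega_full_def by blast
qed

lemma omega_diag_scaleR:
  assumes "V \<in> omega_diag" "0 < c"
  shows "c *\<^sub>R V \<in> omega_diag"
proof -
  obtain D1 D2 :: "real^'a^'a" where D: "V = kron D2 D1" "D1 \<in> posdiag_matrices" "D2 \<in> posdiag_matrices"
    using assms(1) by (auto simp: omega_diag_def)
  then have "c *\<^sub>R V = kron D2 (c *\<^sub>R D1)" "c *\<^sub>R D1 \<in> posdiag_matrices"
    using assms(2) by (simp_all add: scaleR_kron posdiag_matrices_def)
  then show ?thesis
    using D(3) unfolding omega_diag_def by blast
qed

lemma omega_diag_subset_Omega_full: "omega_diag \<subseteq> Omega_full"
  unfolding omega_diag_def Omega_full_def using posdiag_posdef by blast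

lemma posdef_whitened:
  fixes S Y :: "real^'m^'m"
  assumes "det Y \<noteq> 0" "S \<in> posdef_matrices"
  shows "transpose Y ** matrix_inv S ** Y \<in> posdef_matrices"
  by (intro posdef_congruence posdef_matrix_inv assms)

lemma Omega_full_quadratic_form_pos:
  assumes "det Y \<noteq> 0" "V \<in> Omega_full"
  shows "0 < vec_of Y \<bullet> (matrix_inv V *v vec_of Y)"
  using assms(2) trace_posdef_quotient(1)[OF _ posdef_whitened[OF assms(1)]]
  by (auto simp: Omega_full_def quadratic_form_kron)

text \<open>Since ln(det C) = ln((det Y)^2) - ln(det S1), the determinants of both factors cancel
  against the log-determinant of the Kronecker product, leaving a bound in terms of \<open>Y\<close>
  alone.\<close>

lemma neg_loglik_kron_ge:
  fixes Y S1 S2 :: "real^'m^'m"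
  defines "m \<equiv> real CARD('m)"
  assumes Y: "det Y \<noteq> 0" and S: "S1 \<in> posdef_matrices" "S2 \<in> posdef_matrices"
  shows "m * (ln ((det Y)\<^sup>2) + m - m * ln m) \<le> neg_loglik Y (kron S2 S1)"
proof -
  let ?C = "transpose Y ** matrix_inv S1 ** Y"
  let ?q = "trace (?C ** matrix_inv S2)"
  have d: "0 < det S1" "0 < (det Y)\<^sup>2" "0 < m"
    using posdef_det_pos[OF S(1)] Y by (simp_all add: m_def)
  have "det ?C = (det Y)\<^sup>2 / det S1"
    using d(1) by (simp add: det_mul det_matrix_inv power2_eq_square)
  then have "ln (det ?C) = ln ((det Y)\<^sup>2) - ln (det S1)"
    using ln_divide_pos[OF d(2,1)] by (simp only:)
  then have "ln ((det Y)\<^sup>2) - ln (det S1) - ln (det S2) \<le> ?q / m - m + m * ln m"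
    using trace_posdef_quotient(2)[OF S(2) posdef_whitened[OF Y S(1)]] by (simp add: m_def)
  then have "m * (ln ((det Y)\<^sup>2) + m - m * ln m) \<le> m * (ln (det S1) + ln (det S2) + ?q / m)"
    using d(3) by (intro mult_left_mono) simp_all
  also have "\<dots> = neg_loglik Y (kron S2 S1)"
    using d(3) by (simp add: neg_loglik_def det_kron_posdef(2)[OF S] quadratic_form_kron[OF S]
        algebra_simps flip: m_def)
  finally show ?thesis .
qed

lemma Omega_full_normal_mle_exists:
  fixes Y :: "real^'m^'m"
  assumes Y: "det Y \<noteq> 0"
  obtains V where "is_arg_max (normal_lik Y) (\<lambda>V. V \<in> Omega_full) V"
proof -
  define m where "m = real CARD('m)"
  have m: "0 < m" by (simp add: m_def)
  \<comment> \<open>With this \<open>S\<close>, Y^t S^(-1) Y = m I, the equality case of the bound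
    in \<open>neg_loglik_kron_ge\<close> when the other factor is the identity.\<close>
  define S where "S = (1 / m) *\<^sub>R (Y ** transpose Y)"
  have "transpose (transpose Y) ** mat 1 ** transpose Y \<in> posdef_matrices"
    using Y by (intro posdef_congruence mat_1_posdef) simp
  then have S: "S \<in> posdef_matrices"
    using m by (simp add: S_def posdef_scaleR)
  have "(Y ** transpose Y) ** (matrix_inv (transpose Y) ** matrix_inv Y) = mat 1"
    using Y by (metis det_transpose matrix_inv_mult(1) matrix_mul_assoc matrix_mul_rid)
  then have "matrix_inv (Y ** transpose Y) = matrix_inv (transpose Y) ** matrix_inv Y"
    by (rule matrix_inv_unique)
  then have inv_S: "matrix_inv S = m *\<^sub>R (matrix_inv (transpose Y) ** matrix_inv Y)"
    using Y m by (simp add: S_def matrix_inv_scaleR det_mul)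
  have "transpose Y ** (matrix_inv (transpose Y) ** matrix_inv Y) ** Y = mat 1"
    using Y by (metis det_transpose matrix_inv_mult matrix_mul_assoc matrix_mul_rid)
  then have "transpose Y ** matrix_inv S ** Y = m *\<^sub>R mat 1"
    by (simp add: inv_S matrix_scalar_ac flip: scalar_matrix_assoc)
  moreover have "matrix_inv (mat 1 :: real^'m^'m) = mat 1"
    by (rule matrix_inv_unique) simp
  ultimately have "transpose Y ** matrix_inv S ** Y ** matrix_inv (mat 1) = m *\<^sub>R mat 1"
    by simp
  then have tr: "trace (transpose Y ** matrix_inv S ** Y ** matrix_inv (mat 1)) = m * m"
    by (simp only:) (simp add: trace_def mat_def m_def)
  have "det S = (det Y)\<^sup>2 / m ^ CARD('m)"
    by (simp add: S_def det_scaleR det_mul power2_eq_square field_simps)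
  then have "ln (det S) = ln ((det Y)\<^sup>2) - ln (m ^ CARD('m))"
    using ln_divide_pos[of "(det Y)\<^sup>2" "m ^ CARD('m)"] Y m by simp
  then have ln_S: "ln (det S) = ln ((det Y)\<^sup>2) - m * ln m"
    using m by (simp add: ln_realpow flip: m_def)
  have "neg_loglik Y (kron (mat 1) S) = m * (ln ((det Y)\<^sup>2) + m - m * ln m)"
    unfolding neg_loglik_def det_kron_posdef(2)[OF S mat_1_posdef]
      quadratic_form_kron[OF S mat_1_posdef] tr ln_S
    by (simp add: algebra_simps flip: m_def)
  then have "neg_loglik Y (kron (mat 1) S) \<le> neg_loglik Y V'" if "V' \<in> Omega_full" for V'
    using neg_loglik_kron_ge[OF Y] that by (auto simp: Omega_full_def m_def)
  moreover have "kron (mat 1) S \<in> Omega_full"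
    using S mat_1_posdef unfolding Omega_full_def by blast
  ultimately show ?thesis
    using that normal_lik_arg_max_iff[OF Omega_full_det_pos] by blast
qed

section \<open>The normal likelihood over the diagonal model\<close>

text \<open>The left side is the value of t \<mapsto> ln t + b/t at its minimum t = b.\<close>

lemma ln_add_divide_ge:
  fixes t b :: real
  assumes "0 < t" "0 < b"
  shows "ln b + 1 \<le> ln t + b / t"
proof -
  have "ln (b / t) \<le> b / t - 1"
    using assms by (intro ln_le_minus_one) simp
  then show ?thesis
    using ln_divide_pos[OF assms(2,1)] by simp
qed

lemma ln_add_divide_coercive:
  fixes a K :: real
  assumes "0 < a"
  obtains lo hi where "0 < lo" "\<And>t. 0 < t \<Longrightarrow> ln t + a / t \<le> K \<Longrightarrow> lo \<le> t \<and> t \<le> hi"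
proof -
  \<comment> \<open>Half of a/t absorbs ln t through \<open>ln_add_divide_ge\<close>; the other half
    is then at most K - 1 - ln(a/2), which keeps t away from 0. The maximum with 1 keeps
    \<open>B\<close> positive.\<close>
  define B where "B = max 1 (K - 1 - ln (a / 2))"
  show ?thesis
  proof (rule that[of "a / (2 * B)" "exp K"])
    show "0 < a / (2 * B)"
      using assms by (simp add: B_def)
    fix t :: real assume t: "0 < t" "ln t + a / t \<le> K"
    have "0 < a / t" using assms t by simp
    then have "ln t \<le> K" using t by linarith
    then have "t \<le> exp K"
      using t by (metis exp_le_cancel_iff exp_ln)
    moreover have "ln (a / 2) + 1 + a / (2 * t) \<le> ln t + a / t"
    proof -
      have "a / 2 / t = a / (2 * t)" "a / t = a / (2 * t) + a / (2 * t)"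
        by simp_all
      then show ?thesis
        using ln_add_divide_ge[of t "a / 2"] t(1) assms by linarith
    qed
    then have "a / (2 * t) \<le> B"
      using t(2) by (simp add: B_def)
    then have "a / (2 * B) \<le> t"
      using t(1) by (simp add: B_def field_simps)
    ultimately show "a / (2 * B) \<le> t \<and> t \<le> exp K" by simp
  qed
qed

text \<open>Every term is bounded below, so a bound on the sum bounds each term. By coercivity the
  tables no worse than \<open>u\<close> lie in a box with positive lower corner; its intersection
  with \<open>T\<close> is compact, although positivity itself is not a closed condition.\<close>

lemma sum_ln_add_divide_attains_min:
  fixes a u :: "real^'k" and T :: "(real^'k) set"
  assumes a: "\<And>p. 0 < a $ p" and T: "closed T" and u: "u \<in> T" "\<And>p. 0 < u $ p"
  obtains v where "v \<in> T" "\<And>p. 0 < v $ p"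
    "\<forall>v'\<in>T. (\<forall>p. 0 < v' $ p) \<longrightarrow>
      (\<Sum>p\<in>UNIV. ln (v $ p) + a $ p / v $ p) \<le> (\<Sum>p\<in>UNIV. ln (v' $ p) + a $ p / v' $ p)"
proof -
  define g where "g v = (\<Sum>p\<in>UNIV. ln (v $ p) + a $ p / v $ p)" for v :: "real^'k"
  \<comment> \<open>The added sum compensates for the lower bounds ln a + 1 of the other terms,
    whatever their sign.\<close>
  define K where "K = g u + (\<Sum>p\<in>UNIV. \<bar>ln (a $ p) + 1\<bar>)"
  have "\<forall>p. \<exists>lo hi. 0 < lo \<and> (\<forall>t>0. ln t + a $ p / t \<le> K \<longrightarrow> lo \<le> t \<and> t \<le> hi)"
    using ln_add_divide_coercive[OF a] by metis
  then obtain lo hi where lo: "\<And>p. 0 < lo p"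
    and lohi: "\<And>p t. 0 < t \<Longrightarrow> ln t + a $ p / t \<le> K \<Longrightarrow> lo p \<le> t \<and> t \<le> hi p"
    by metis
  define C where "C = T \<inter> cbox (\<chi> p. lo p) (\<chi> p. hi p)"
  have pos_C: "0 < v $ p" if "v \<in> C" for v p
    using that lo[of p] by (auto simp: C_def mem_box_cart intro: less_le_trans)
  have sublevel: "v \<in> C" if v: "v \<in> T" "\<And>p. 0 < v $ p" "g v \<le> g u" for v
  proof -
    have "ln (v $ p) + a $ p / v $ p \<le> K" for p
    proof -
      have "(\<Sum>q\<in>UNIV - {p}. - \<bar>ln (a $ q) + 1\<bar>) \<le> (\<Sum>q\<in>UNIV - {p}. ln (v $ q) + a $ q / v $ q)"
      proof (rule sum_mono)
        fix q
        show "- \<bar>ln (a $ q) + 1\<bar> \<le> ln (v $ q) + a $ q / v $ q"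
          using ln_add_divide_ge[OF v(2)[of q] a[of q]] by linarith
      qed
      moreover have "g v = ln (v $ p) + a $ p / v $ p + (\<Sum>q\<in>UNIV - {p}. ln (v $ q) + a $ q / v $ q)"
        unfolding g_def by (rule sum.remove) simp_all
      moreover have "(\<Sum>q\<in>UNIV - {p}. \<bar>ln (a $ q) + 1\<bar>) \<le> (\<Sum>q\<in>UNIV. \<bar>ln (a $ q) + 1\<bar>)"
        by (rule sum_mono2) simp_all
      ultimately show ?thesis
        using v(3) by (simp add: K_def sum_negf)
    qed
    then show ?thesis
      using lohi v(1,2) by (simp add: C_def mem_box_cart)
  qed
  have nz: "\<forall>v\<in>C. v $ p \<noteq> 0" for p
    using pos_C by (metis less_irrefl)
  have "compact C"
    unfolding C_def using T by (simp add: closed_Int_compact)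
  moreover have "C \<noteq> {}"
    using sublevel[OF u] by auto
  moreover have "continuous_on C g"
    unfolding g_def by (intro continuous_intros nz)
  ultimately obtain v where v: "v \<in> C" "\<And>v'. v' \<in> C \<Longrightarrow> g v \<le> g v'"
    using continuous_attains_inf[of C g] by blast
  have "g v \<le> g v'" if "v' \<in> T" "\<And>p. 0 < v' $ p" for v'
  proof (cases "g v' \<le> g u")
    case True
    then show ?thesis using v(2) sublevel that by blast
  next
    case False
    then show ?thesis using v(2)[OF sublevel[OF u]] by simp
  qed
  then show ?thesis
    using that[of v] v(1) pos_C by (auto simp: g_def C_def)
qed

section \<open>Diagonal matrices and rank-one tables\<close>

definition diag_of :: "real^'k \<Rightarrow> real^'k^'k" where
  "diag_of v = (\<chi> i j. if i = j then v $ i else 0)"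

lemma det_diag_of: "det (diag_of v) = (\<Prod>i\<in>UNIV. v $ i)"
  unfolding diag_of_def by (subst det_diagonal) auto

lemma diag_of_mult_vec: "diag_of v *v y = (\<chi> i. v $ i * y $ i)"
proof -
  have "(\<Sum>j\<in>UNIV. (if i = j then v $ i else 0) * y $ j) =
      (\<Sum>j\<in>UNIV. if j = i then v $ i * y $ i else 0)" for i
    by (intro sum.cong) auto
  then show ?thesis
    by (simp add: diag_of_def matrix_vector_mult_def vec_eq_iff)
qed

lemma matrix_inv_diag_of:
  fixes v :: "real^'k"
  assumes nz: "\<And>i. v $ i \<noteq> 0"
  shows "matrix_inv (diag_of v) = diag_of (\<chi> i. 1 / v $ i)"
proof (rule matrix_inv_unique)
  have "(\<Sum>k\<in>UNIV. (if i = k then v $ i else 0) * (if k = j then 1 / v $ k else 0)) =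
      (\<Sum>k\<in>UNIV. if k = i then if i = j then 1 else 0 else 0)" for i j
    by (intro sum.cong) (auto simp: nz)
  then have "(\<Sum>k\<in>UNIV. (if i = k then v $ i else 0) * (if k = j then 1 / v $ k else 0)) =
      (if i = j then 1 else 0)" for i j
    by (simp only:) simp
  then show "diag_of v ** diag_of (\<chi> i. 1 / v $ i) = mat 1"
    unfolding diag_of_def matrix_matrix_mult_def mat_def vec_eq_iff vec_lambda_beta by blast
qed

lemma neg_loglik_diag_of:
  fixes v :: "real^('m::finite \<times> 'm)"
  assumes "\<And>p. 0 < v $ p"
  shows "neg_loglik Y (diag_of v) = (\<Sum>p\<in>UNIV. ln (v $ p) + (vec_of Y $ p)\<^sup>2 / v $ p)"
proof -
  have "ln (\<Prod>p\<in>UNIV. v $ p) = (\<Sum>p\<in>UNIV. ln (v $ p))"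
    by (rule ln_prod) (use assms in \<open>auto simp: less_le\<close>)
  moreover have "v $ p \<noteq> 0" for p
    using assms[of p] by simp
  ultimately show ?thesis
    by (simp add: neg_loglik_def det_diag_of matrix_inv_diag_of diag_of_mult_vec inner_vec_def
        sum.distrib power2_eq_square)
qed

text \<open>A positive table is an outer product \<open>v (i, j) = a i * b j\<close> iff its \<open>2 \<times> 2\<close> minors vanish,
  which is a closed condition.\<close>

lemma omega_diag_eq_rank_one:
  "omega_diag = {diag_of v | v :: real^('m::finite \<times> 'm).
     v \<in> {v. \<forall>i j k l. v $ (i, j) * v $ (k, l) = v $ (i, l) * v $ (k, j)} \<and> (\<forall>p. 0 < v $ p)}"
  (is "_ = {diag_of v | v. v \<in> ?T \<and> ?pos v}")
proof (intro set_eqI iffI)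
  fix V :: "real^('m \<times> 'm)^('m \<times> 'm)" assume "V \<in> omega_diag"
  then obtain D1 D2 :: "real^'m^'m" where
    V: "V = kron D2 D1" and D: "D1 \<in> posdiag_matrices" "D2 \<in> posdiag_matrices"
    by (auto simp: omega_diag_def)
  define v :: "real^('m \<times> 'm)" where "v = (\<chi> p. D2 $ fst p $ fst p * D1 $ snd p $ snd p)"
  have "V $ p $ q = diag_of v $ p $ q" for p q
    using D by (cases p; cases q) (auto simp: V kron_def diag_of_def v_def posdiag_matrices_def)
  then have "V = diag_of v"
    unfolding vec_eq_iff by blast
  moreover have "v \<in> ?T"
    by (simp add: v_def mult_ac)
  moreover have "?pos v"
    using D by (simp add: v_def posdiag_matrices_def)
  ultimately show "V \<in> {diag_of v | v. v \<in> ?T \<and> ?pos v}"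
    by blast
next
  fix V :: "real^('m \<times> 'm)^('m \<times> 'm)" assume "V \<in> {diag_of v | v. v \<in> ?T \<and> ?pos v}"
  then obtain v where V: "V = diag_of v" and v: "v \<in> ?T" "?pos v"
    by blast
  \<comment> \<open>Any base index works: the table is recovered from its entries with one index
    equal to \<open>o'\<close>, and dividing by the common entry in \<open>D1\<close> avoids
    counting it twice.\<close>
  define o' :: 'm where "o' = undefined"
  define D1 :: "real^'m^'m" where "D1 = diag_of (\<chi> j. v $ (o', j) / v $ (o', o'))"
  define D2 :: "real^'m^'m" where "D2 = diag_of (\<chi> i. v $ (i, o'))"
  have outer: "v $ (i, j) = v $ (i, o') * (v $ (o', j) / v $ (o', o'))" for i j
  proof -
    have "v $ (i, j) * v $ (o', o') = v $ (i, o') * v $ (o', j)"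
      using v(1) by blast
    moreover have "v $ (o', o') \<noteq> 0"
      using v(2) by (metis less_irrefl)
    ultimately show ?thesis
      by (simp add: nonzero_eq_divide_eq)
  qed
  have "V $ p $ q = kron D2 D1 $ p $ q" for p q
    using outer[of "fst p" "snd p"]
    by (auto simp: V kron_def D1_def D2_def diag_of_def prod_eq_iff)
  then have "V = kron D2 D1"
    unfolding vec_eq_iff by blast
  moreover have "D1 \<in> posdiag_matrices" "D2 \<in> posdiag_matrices"
    using v(2) by (auto simp: D1_def D2_def diag_of_def posdiag_matrices_def)
  ultimately show "V \<in> omega_diag"
    unfolding omega_diag_def by blast
qed

lemma closed_rank_one_tables:
  "closed {v :: real^('m::finite \<times> 'm). \<forall>i j k l. v $ (i, j) * v $ (k, l) = v $ (i, l) * v $ (k, j)}"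
  by (intro closed_Collect_all closed_Collect_eq continuous_intros)

lemma omega_diag_normal_mle_exists:
  fixes Y :: "real^'m^'m"
  assumes Y: "\<And>i j. Y $ i $ j \<noteq> 0"
  obtains V where "is_arg_max (normal_lik Y) (\<lambda>V. V \<in> omega_diag) V"
proof -
  let ?T = "{v :: real^('m \<times> 'm). \<forall>i j k l. v $ (i, j) * v $ (k, l) = v $ (i, l) * v $ (k, j)}"
  let ?a = "(\<chi> p. (vec_of Y $ p)\<^sup>2) :: real^('m \<times> 'm)"
  have a: "0 < ?a $ p" for p
    using Y by (simp add: vec_of_def)
  \<comment> \<open>The table of ones is a feasible starting point for the minimization.\<close>
  have u: "(\<chi> p. 1) \<in> ?T" "\<And>p. 0 < ((\<chi> p. 1) :: real^('m \<times> 'm)) $ p"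
    by simp_all
  obtain v where v: "v \<in> ?T" "\<And>p. 0 < v $ p"
    and v_min: "\<forall>v'\<in>?T. (\<forall>p. 0 < v' $ p) \<longrightarrow>
      (\<Sum>p\<in>UNIV. ln (v $ p) + ?a $ p / v $ p) \<le> (\<Sum>p\<in>UNIV. ln (v' $ p) + ?a $ p / v' $ p)"
    using sum_ln_add_divide_attains_min[OF a closed_rank_one_tables u] by blast
  have min: "neg_loglik Y (diag_of v) \<le> neg_loglik Y V'" if mem': "V' \<in> omega_diag" for V'
  proof -
    obtain v' where v': "V' = diag_of v'" "v' \<in> ?T" "\<And>p. 0 < v' $ p"
      using mem' unfolding omega_diag_eq_rank_one by blast
    show ?thesis
      using v_min[rule_format, OF v'(2,3)]
      by (simp add: v'(1) neg_loglik_diag_of[OF v(2)] neg_loglik_diag_of[OF v'(3)])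
  qed
  have mem: "diag_of v \<in> omega_diag"
    using v unfolding omega_diag_eq_rank_one by blast
  have det: "0 < det V" if "V \<in> omega_diag" for V :: "real^('m \<times> 'm)^('m \<times> 'm)"
    using that by (auto simp: omega_diag_eq_rank_one det_diag_of intro!: prod_pos)
  show ?thesis
    using that normal_lik_arg_max_iff[OF det] mem min by blast
qed

section \<open>Genericity of the data\<close>

text \<open>Evaluation is a ring homomorphism, so it passes through the Leibniz expansion.\<close>

lemma poly_det:
  fixes P :: "'a::comm_ring_1 poly^'n^'n"
  shows "poly (det P) x = det (\<chi> i j. poly (P $ i $ j) x)"
  by (simp add: det_def poly_sum poly_prod poly_of_int)

text \<open>For t \<noteq> 0 put s = 1/t: singularity of tI + A means that s is a root of det(I +
  sA). This polynomial in s has value 1 at 0, so it is nonzero and has finitely many roots.\<close>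

lemma finite_singular_shifts:
  fixes A :: "real^'n^'n"
  shows "finite {t. det (t *\<^sub>R mat 1 + A) = 0}"
proof -
  define P where "P = det (\<chi> i j. [:if i = j then 1 else 0, A $ i $ j:])"
  have P: "poly P s = det (mat 1 + s *\<^sub>R A)" for s
    by (simp add: P_def poly_det mat_def plus_vec_def scaleR_vec_def)
  have "poly P 0 = 1"
    by (simp add: P)
  then have "finite {s. poly P s = 0}"
    by (intro poly_roots_finite) auto
  moreover have "{t. det (t *\<^sub>R mat 1 + A) = 0} \<subseteq> insert 0 (inverse ` {s. poly P s = 0})"
  proof
    fix t assume t: "t \<in> {t. det (t *\<^sub>R mat 1 + A) = 0}"
    show "t \<in> insert 0 (inverse ` {s. poly P s = 0})"
    proof (cases "t = 0")
      case False
      then have "t *\<^sub>R mat 1 + A = t *\<^sub>R (mat 1 + inverse t *\<^sub>R A)"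
        by (simp add: scaleR_add_right)
      then have "det (mat 1 + inverse t *\<^sub>R A) = 0"
        using t False by (simp add: det_scaleR)
      then show ?thesis
        using P[of "inverse t"] by (auto intro!: image_eqI[of _ _ "inverse t"])
    qed simp
  qed
  ultimately show ?thesis
    using finite_subset by blast
qed

lemma continuous_on_det:
  fixes f :: "'a::topological_space \<Rightarrow> real^'n^'n"
  assumes "continuous_on S f"
  shows "continuous_on S (\<lambda>x. det (f x))"
  unfolding det_def by (intro continuous_intros assms)

text \<open>By Fubini and translation invariance it suffices that every line in the direction of the
  identity meets the singular matrices in a finite set.\<close>

lemma AE_det_nonzero: "AE A in lborel. det (A :: real^'n^'n) \<noteq> 0"
proof -
  have closed: "closed {p :: real \<times> (real^'n^'n). det (fst p *\<^sub>R mat 1 + snd p) = 0}"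
    by (intro closed_Collect_eq continuous_on_det continuous_intros)
  have "{p \<in> space (lborel \<Otimes>\<^sub>M lborel). det (fst p *\<^sub>R mat 1 + snd p :: real^'n^'n) \<noteq> 0} =
      - {p. det (fst p *\<^sub>R mat 1 + snd p) = 0}"
    by (auto simp: space_pair_measure)
  also have "\<dots> \<in> sets (lborel \<Otimes>\<^sub>M lborel)"
    unfolding lborel_prod sets_lborel by (intro borel_open open_Compl closed)
  finally have meas: "{p \<in> space (lborel \<Otimes>\<^sub>M lborel). det (fst p *\<^sub>R mat 1 + snd p :: real^'n^'n) \<noteq> 0}
      \<in> sets (lborel \<Otimes>\<^sub>M lborel)" .
  have "AE t in lborel. det (t *\<^sub>R mat 1 + A) \<noteq> 0" for A :: "real^'n^'n"
    using AE_not_in[OF finite_imp_null_set_lborel[OF finite_singular_shifts[of A]]] by simp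
  \<comment> \<open>Fubini exchanges the quantifiers: almost every shift t is good for almost every
    matrix.\<close>
  then have "AE t in lborel. AE A in lborel. det (t *\<^sub>R mat 1 + A :: real^'n^'n) \<noteq> 0"
    by (subst lborel_pair.AE_commute[OF meas]) simp
  \<comment> \<open>Lebesgue measure on the line is not the zero measure, so a good t exists;
    translation by tI then removes the shift.\<close>
  then obtain t where t: "AE A in lborel. det (t *\<^sub>R mat 1 + A :: real^'n^'n) \<noteq> 0"
    using eventually_happens'[of "ae_filter (lborel :: real measure)"]
    by (auto simp: ae_filter_eq_bot_iff)
  have "{A :: real^'n^'n. det A \<noteq> 0} \<in> sets borel"
    by (intro borel_open open_Collect_neq continuous_on_det continuous_intros)
  then have "(AE A in distr lborel borel ((+) (t *\<^sub>R mat 1)). det (A :: real^'n^'n) \<noteq> 0) \<longleftrightarrow>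
      (AE A in lborel. det (t *\<^sub>R mat 1 + A :: real^'n^'n) \<noteq> 0)"
    by (subst AE_distr_iff) simp_all
  then show ?thesis
    unfolding lborel_distr_plus using t by (rule iffD2)
qed

lemma AE_entries_nonzero: "AE A in lborel. \<forall>i j. (A :: real^'n^'m) $ i $ j \<noteq> 0"
proof -
  have "AE A in lborel. (A :: real^'n^'m) $ i $ j \<noteq> 0" for i j
  proof -
    have "axis i (axis j 1) \<in> (Basis :: (real^'n^'m) set)"
      by (simp add: axis_in_Basis_iff)
    then have "negligible {A :: real^'n^'m. A \<bullet> axis i (axis j 1) = 0}"
      by (rule negligible_standard_hyperplane)
    then have "negligible {A :: real^'n^'m. A $ i $ j = 0}"
      by (simp add: inner_axis)
    \<comment> \<open>Negligibility refers to the completed measure; closedness makes the set Borel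
      and hence null for \<open>lborel\<close>.\<close>
    moreover have "closed {A :: real^'n^'m. A $ i $ j = 0}"
      by (intro closed_Collect_eq continuous_intros)
    ultimately have "{A :: real^'n^'m. A $ i $ j = 0} \<in> null_sets lborel"
      by (simp add: negligible_iff_null_sets null_sets_completion_iff borel_closed)
    from AE_not_in[OF this] show ?thesis by simp
  qed
  then show ?thesis
    by (simp add: AE_all_countable)
qed

section \<open>The likelihood ratio statistic\<close>

text \<open>The deterministic core. Invertibility of \<open>Y\<close> gives existence over \<Omega>
  and positive quadratic forms over both models; nonzero entries give existence over \<omega>.
  Positivity of the suprema places both logarithms in their genuine domain.\<close>

lemma likelihood_ratio_at_regular_data:
  fixes h :: "real \<Rightarrow> real" and x_h :: real and Y :: "real^'m^'m"
  assumes h_nonneg: "\<And>x. 0 \<le> x \<Longrightarrow> 0 \<le> h x"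
    and x_h_pos: "0 < x_h"
    and x_h_max: "is_arg_max (\<lambda>x. x powr ((real CARD('m))\<^sup>2 / 2) * h x) (\<lambda>x. 0 \<le> x) x_h"
    and max_pos: "0 < x_h powr ((real CARD('m))\<^sup>2 / 2) * h x_h"
    and det_Y: "det Y \<noteq> 0" and entries_Y: "\<And>i j. Y $ i $ j \<noteq> 0"
  shows "bounded (elliptical_lik h Y ` Omega_full) \<and>
     (\<forall>W \<in> {Omega_full, omega_diag}.
        (\<exists>V. is_arg_max (normal_lik Y) (\<lambda>V. V \<in> W) V) \<and>
        (\<forall>V. is_arg_max (normal_lik Y) (\<lambda>V. V \<in> W) V \<longrightarrow>
             is_arg_max (elliptical_lik h Y) (\<lambda>V. V \<in> W)
               (((real CARD('m))\<^sup>2 / x_h) *\<^sub>R V))) \<and>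
     0 < (SUP V\<in>Omega_full. elliptical_lik h Y V) \<and>
     0 < (SUP V\<in>omega_diag. elliptical_lik h Y V) \<and>
     (\<forall>V_Omega V_omega.
        is_arg_max (normal_lik Y) (\<lambda>V. V \<in> Omega_full) V_Omega \<and>
        is_arg_max (normal_lik Y) (\<lambda>V. V \<in> omega_diag) V_omega \<longrightarrow>
        2 * ln (SUP V\<in>Omega_full. elliptical_lik h Y V) -
        2 * ln (SUP V\<in>omega_diag. elliptical_lik h Y V) =
        ln (det V_omega) - ln (det V_Omega))"
proof -
  let ?n = "(real CARD('m))\<^sup>2"
  define K where "K = x_h powr (?n / 2) * h x_h"
  have K: "0 < K"
    using max_pos by (simp add: K_def)
  \<comment> \<open>Positivity of determinants and quadratic forms over \<omega> is inherited from
    \<Omega>; closure under scaling has its own proof.\<close>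
  have sub: "V \<in> Omega_full" if "V \<in> omega_diag" for V :: "real^('m \<times> 'm)^('m \<times> 'm)"
    using that omega_diag_subset_Omega_full by blast
  have mle_full:
    "is_arg_max (elliptical_lik h Y) (\<lambda>V. V \<in> Omega_full) ((?n / x_h) *\<^sub>R V)"
    "(SUP V\<in>Omega_full. elliptical_lik h Y V) = K * exp (- ((ln (det V) + ?n * ln ?n) / 2))"
    "bounded (elliptical_lik h Y ` Omega_full)"
    if V: "is_arg_max (normal_lik Y) (\<lambda>V. V \<in> Omega_full) V" for V
    unfolding K_def
    by (rule elliptical_lik_mle[OF _ _ _ _ x_h_pos x_h_max V],
        (blast intro: Omega_full_det_pos Omega_full_quadratic_form_pos[OF det_Y] Omega_full_scaleR h_nonneg)+)+
  have mle_diag: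
    "is_arg_max (elliptical_lik h Y) (\<lambda>V. V \<in> omega_diag) ((?n / x_h) *\<^sub>R V)"
    "(SUP V\<in>omega_diag. elliptical_lik h Y V) = K * exp (- ((ln (det V) + ?n * ln ?n) / 2))"
    "bounded (elliptical_lik h Y ` omega_diag)"
    if V: "is_arg_max (normal_lik Y) (\<lambda>V. V \<in> omega_diag) V" for V
    unfolding K_def
    by (rule elliptical_lik_mle[OF _ _ _ _ x_h_pos x_h_max V],
        (blast intro: Omega_full_det_pos[OF sub] Omega_full_quadratic_form_pos[OF det_Y sub]
          omega_diag_scaleR h_nonneg)+)+
  \<comment> \<open>The terms 2 ln K and n ln n are common to both models and cancel in the
    difference.\<close>
  have ln_sup: "2 * ln (K * exp (- ((d + ?n * ln ?n) / 2))) = 2 * ln K - d - ?n * ln ?n" for d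
    using K by (simp add: ln_mult_pos add_divide_distrib)
  obtain V0 where V0: "is_arg_max (normal_lik Y) (\<lambda>V. V \<in> Omega_full) V0"
    by (rule Omega_full_normal_mle_exists[OF det_Y])
  obtain V1 where V1: "is_arg_max (normal_lik Y) (\<lambda>V. V \<in> omega_diag) V1"
    by (rule omega_diag_normal_mle_exists[OF entries_Y])
  have lr: "2 * ln (SUP V\<in>Omega_full. elliptical_lik h Y V) -
      2 * ln (SUP V\<in>omega_diag. elliptical_lik h Y V) = ln (det V') - ln (det V)"
    if V: "is_arg_max (normal_lik Y) (\<lambda>V. V \<in> Omega_full) V"
      and V': "is_arg_max (normal_lik Y) (\<lambda>V. V \<in> omega_diag) V'" for V V'
    unfolding mle_full(2)[OF V] mle_diag(2)[OF V'] ln_sup by simp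
  have "0 < (SUP V\<in>Omega_full. elliptical_lik h Y V)"
    unfolding mle_full(2)[OF V0] using K by simp
  moreover have "0 < (SUP V\<in>omega_diag. elliptical_lik h Y V)"
    unfolding mle_diag(2)[OF V1] using K by simp
  ultimately show ?thesis
    using mle_full(1) mle_full(3)[OF V0] mle_diag(1) lr V0 V1 by blast
qed

theorem mainTheorem4:
  fixes h :: "real \<Rightarrow> real" and x_h :: real
    and M :: "'a measure" and Y :: "'a \<Rightarrow> real^'m^'m" and Sr Sc :: "real^'m^'m"
  assumes h_nonneg: "\<And>x. 0 \<le> x \<Longrightarrow> 0 \<le> h x"
    and h_meas: "(\<lambda>y :: real^('m \<times> 'm). h (y \<bullet> y)) \<in> borel_measurable borel"
    and h_density: "(\<integral>\<^sup>+ y. ennreal (h ((y :: real^('m \<times> 'm)) \<bullet> y)) \<partial>lborel) = 1"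
    and x_h_pos: "0 < x_h"
    and x_h_max: "is_arg_max (\<lambda>x. x powr ((real CARD('m))\<^sup>2 / 2) * h x) (\<lambda>x. 0 \<le> x) x_h"
    and max_pos: "0 < x_h powr ((real CARD('m))\<^sup>2 / 2) * h x_h"
    and Sr: "Sr \<in> posdef_matrices" and Sc: "Sc \<in> posdef_matrices"
    and M: "prob_space M"
    and Y: "distributed M lborel Y (\<lambda>y. ennreal (elliptical_density h Sr Sc y))"
  shows "AE s in M.
     bounded (elliptical_lik h (Y s) ` Omega_full) \<and>
     (\<forall>W \<in> {Omega_full, omega_diag}.
        (\<exists>V. is_arg_max (normal_lik (Y s)) (\<lambda>V. V \<in> W) V) \<and>
        (\<forall>V. is_arg_max (normal_lik (Y s)) (\<lambda>V. V \<in> W) V \<longrightarrow>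
             is_arg_max (elliptical_lik h (Y s)) (\<lambda>V. V \<in> W)
               (((real CARD('m))\<^sup>2 / x_h) *\<^sub>R V))) \<and>
     0 < (SUP V\<in>Omega_full. elliptical_lik h (Y s) V) \<and>
     0 < (SUP V\<in>omega_diag. elliptical_lik h (Y s) V) \<and>
     (\<forall>V_Omega V_omega.
        is_arg_max (normal_lik (Y s)) (\<lambda>V. V \<in> Omega_full) V_Omega \<and>
        is_arg_max (normal_lik (Y s)) (\<lambda>V. V \<in> omega_diag) V_omega \<longrightarrow>
        2 * ln (SUP V\<in>Omega_full. elliptical_lik h (Y s) V) -
        2 * ln (SUP V\<in>omega_diag. elliptical_lik h (Y s) V) =
        ln (det V_omega) - ln (det V_Omega))"
proof -
  interpret prob_space M by (rule M)
  \<comment> \<open>The exceptional data form a closed set, which supplies the measurability needed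
    for the transfer to \<open>M\<close>.\<close>
  have closed: "closed ({y :: real^'m^'m. det y = 0} \<union> (\<Union>i j. {y. y $ i $ j = 0}))"
    by (intro closed_Un closed_UN ballI finite closed_Collect_eq continuous_on_det continuous_intros)
  have pred: "Measurable.pred lborel (\<lambda>y :: real^'m^'m. det y \<noteq> 0 \<and> (\<forall>i j. y $ i $ j \<noteq> 0))"
  proof -
    have "{y :: real^'m^'m. det y \<noteq> 0 \<and> (\<forall>i j. y $ i $ j \<noteq> 0)} =
        - ({y. det y = 0} \<union> (\<Union>i j. {y. y $ i $ j = 0}))"
      by auto
    also have "\<dots> \<in> sets borel"
      by (intro borel_open open_Compl closed)
    finally show ?thesis
      by (simp add: pred_def)
  qed
  have "AE y in lborel. 0 < ennreal (elliptical_density h Sr Sc y) \<longrightarrow>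
      det y \<noteq> 0 \<and> (\<forall>i j. y $ i $ j \<noteq> 0)"
    using AE_det_nonzero AE_entries_nonzero by eventually_elim simp
  \<comment> \<open>The law of \<open>Y\<close> has a density with respect to \<open>lborel\<close>,
    so a Lebesgue-null set of data has probability zero.\<close>
  then have "AE s in M. det (Y s) \<noteq> 0 \<and> (\<forall>i j. Y s $ i $ j \<noteq> 0)"
    by (simp only: distributed_AE2[OF Y pred])
  then show ?thesis
    by (rule eventually_mono)
      (rule likelihood_ratio_at_regular_data[OF h_nonneg x_h_pos x_h_max max_pos], auto)
qed

end
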